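(* Let $m,n\in\{0,1,2,\dots\}$ and let $K_{m,n}$ be the complete bipartite graph whose two independent parts have sizes $m$ and $n$. For every integer $\ell$ with $0\le \ell\le m+n$, $$Z^+_{(\ell)}(K_{m,n}) = \begin{cases} \min(m,n) & \text{if } \ell<\min(m,n),\\ \max(m,n) & \text{if } \min(m,n)\le \ell<\max(m,n),\\ m+n & \text{if } \max(m,n)\le \ell.\end{cases}$$
   Context: All graphs are finite, simple and undirected. Positive semidefinite (psd) color change rule: given the current set $B$ of blue vertices of a graph $G$, let $W_1,\dots,W_k$ be the vertex sets of the connected components of $G-B$. If $u\in B$ and $w\in W_i$ is the only non-blue neighbor of $u$ in the induced subgraph $G[W_i\cup B]$, then $u$ may force $w$ (written $u\to w$), and $w$ becomes blue. The rule is applied iteratively, with the components recomputed from the current blue set. A leak is a vertex that is not allowed to perform any force. For $0\le \ell\le |V(G)|$, a set $B\subseteq V(G)$ is an $\ell$-leaky positive semidefinite forcing set of $G$ if, for every choice of $\ell$ vertices as leaks (chosen after $B$ is fixed; leaks may be inside or outside $B$), starting with exactly $B$ blue, iterated application of the psd color change rule, with forces performed only by non-leak vertices, colors all of $V(G)$ blue. The $\ell$-leaky positive semidefinite forcing number $Z^+_{(\ell)}(G)$ is the minimum cardinality of an $\ell$-leaky positive semidefinite forcing set of $G$. *)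

theory Defs
  imports "Graph_Theory.Graph_Theory"
begin

text \<open>
  A finite simple undirected graph is a symmetric digraph, i.e. an instance of the locale
  \<^locale>\<open>graph\<close>. For such graphs strong components are connected components, so
  \<^const>\<open>pre_digraph.sccs_verts\<close> is the family of vertex sets of the connected components.
\<close>

definition psd_force :: "('a, 'b) pre_digraph \<Rightarrow> 'a set \<Rightarrow> 'a \<Rightarrow> 'a \<Rightarrow> bool" where
  "psd_force G B u w \<longleftrightarrow> u \<in> B \<and>
     (\<exists>W \<in> pre_digraph.sccs_verts (G \<restriction> (verts G - B)).
        w \<in> W \<and> {x \<in> verts G - B. u \<rightarrow>\<^bsub>G \<restriction> (W \<union> B)\<^esub> x} = {w})"

definition leaky_psd_step :: "('a, 'b) pre_digraph \<Rightarrow> 'a set \<Rightarrow> 'a set \<Rightarrow> 'a set \<Rightarrow> bool" where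
  "leaky_psd_step G L B B' \<longleftrightarrow> (\<exists>u w. u \<notin> L \<and> psd_force G B u w \<and> B' = insert w B)"

text \<open>
  A force stays available, until its target is blue, when more vertices become blue. Hence the final
  coloring does not depend on the order of the forces, and asking for some sequence of forces
  that ends in the all-blue coloring is the same as asking that every maximal sequence does.
\<close>

definition leaky_psd_forcing_set :: "('a, 'b) pre_digraph \<Rightarrow> nat \<Rightarrow> 'a set \<Rightarrow> bool" where
  "leaky_psd_forcing_set G l B \<longleftrightarrow> B \<subseteq> verts G \<and>
     (\<forall>L. L \<subseteq> verts G \<and> card L = l \<longrightarrow> (leaky_psd_step G L)\<^sup>*\<^sup>* B (verts G))"

definition leaky_psd_forcing_number :: "('a, 'b) pre_digraph \<Rightarrow> nat \<Rightarrow> nat" where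
  "leaky_psd_forcing_number G l = (LEAST k. \<exists>B. leaky_psd_forcing_set G l B \<and> card B = k)"

end

theory Submission
  imports Defs
begin

text \<open>
  Let \<open>U\<close> and \<open>V\<close> be the two sides. If all of \<open>U\<close> is blue and some vertex of \<open>U\<close> is
  not a leak, then every white vertex is a component of its own, and that vertex forces all of them;
  so a side with more than \<open>l\<close> vertices is an \<open>l\<close>-leaky forcing set. Conversely, if
  \<open>l\<close> is at least the size of \<open>U\<close>, then all of \<open>U\<close> can be leaks, no vertex of \<open>V\<close> is ever
  forced, and every forcing set contains \<open>V\<close>. Finally, while both sides contain a white vertex the
  white graph is connected, so a vertex of \<open>U\<close> can force only the last white vertex of \<open>V\<close>; the
  forcing vertex together with the blue part of \<open>V\<close> shows that there are at least \<open>card V\<close> blue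
  vertices already.
\<close>

lemma dominates_induce_subgraph_iff:
  "u \<rightarrow>\<^bsub>G \<restriction> S\<^esub> v \<longleftrightarrow> u \<in> S \<and> v \<in> S \<and> u \<rightarrow>\<^bsub>G\<^esub> v"
  by (auto simp: arcs_ends_conv)

lemma (in wf_digraph) psd_force_white_adjacent:
  assumes "psd_force G B u w"
  shows "w \<in> verts G - B" and "u \<rightarrow> w"
  using assms by (auto simp: psd_force_def dominates_induce_subgraph_iff)

text \<open>Mutual reachability through white vertices puts \<open>v\<close> in the component of
  \<open>w\<close>, where \<open>u\<close> has only one white neighbor. Stated this way, no
  component has to be named later.\<close>

lemma (in wf_digraph) psd_force_unique:
  assumes force: "psd_force G B u w" and "u \<rightarrow> v"
    and wv: "w \<rightarrow>\<^sup>*\<^bsub>G \<restriction> (verts G - B)\<^esub> v" and vw: "v \<rightarrow>\<^sup>*\<^bsub>G \<restriction> (verts G - B)\<^esub> w"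
  shows "v = w"
proof -
  obtain W where "u \<in> B" and W: "W \<in> pre_digraph.sccs_verts (G \<restriction> (verts G - B))" "w \<in> W"
    and nbrs: "{x \<in> verts G - B. u \<rightarrow>\<^bsub>G \<restriction> (W \<union> B)\<^esub> x} = {w}"
    using force by (auto simp: psd_force_def)
  have "v \<in> W"
    using W wv vw by (auto simp: pre_digraph.sccs_verts_def)
  moreover have "v \<in> verts G - B"
    using wv by (elim reachable_in_vertsE) simp
  ultimately have "v \<in> {x \<in> verts G - B. u \<rightarrow>\<^bsub>G \<restriction> (W \<union> B)\<^esub> x}"
    using \<open>u \<in> B\<close> \<open>u \<rightarrow> v\<close> by (simp add: dominates_induce_subgraph_iff)
  then show ?thesis
    unfolding nbrs by simp
qed

text \<open>A white vertex without white neighbors is a component by itself, so every blue neighbor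
  may force it, however many other white neighbors that one has.\<close>

lemma (in wf_digraph) psd_force_isolated:
  assumes "u \<in> B" and "u \<rightarrow> w" and "w \<notin> B"
    and isolated: "\<And>x. x \<in> verts G - B \<Longrightarrow> \<not> w \<rightarrow> x"
  shows "psd_force G B u w"
proof -
  let ?H = "G \<restriction> (verts G - B)"
  interpret H: wf_digraph ?H
    by (rule wellformed_induce_subgraph)
  have "w \<in> verts G"
    using \<open>u \<rightarrow> w\<close> by (rule adj_in_verts)
  then have "w \<rightarrow>\<^sup>*\<^bsub>?H\<^esub> w"
    using \<open>w \<notin> B\<close> by simp
  \<comment> \<open>A nontrivial path from \<open>w\<close> would start with an arc to a white
    neighbor.\<close>
  moreover have "x = w" if "w \<rightarrow>\<^sup>*\<^bsub>?H\<^esub> x" for x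
    using that
  proof (rule pre_digraph.converse_reachable_cases)
    fix y
    assume "w \<rightarrow>\<^bsub>?H\<^esub> y"
    then show ?thesis
      using isolated by (auto simp: dominates_induce_subgraph_iff)
  qed simp
  ultimately have scc: "{w} \<in> pre_digraph.sccs_verts ?H"
    unfolding pre_digraph.sccs_verts_def by blast
  have nbrs: "{x \<in> verts G - B. u \<rightarrow>\<^bsub>G \<restriction> ({w} \<union> B)\<^esub> x} = {w}"
    using \<open>u \<in> B\<close> \<open>u \<rightarrow> w\<close> \<open>w \<notin> B\<close> \<open>w \<in> verts G\<close> by (auto simp: dominates_induce_subgraph_iff)
  show ?thesis
    unfolding psd_force_def by (intro conjI bexI[OF _ scc] singletonI nbrs assms)
qed

lemma leaky_psd_forcing_set_verts: "leaky_psd_forcing_set G l (verts G)"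
  by (simp add: leaky_psd_forcing_set_def)

lemma leaky_psd_forcing_number_eqI:
  assumes "leaky_psd_forcing_set G l B" and "card B = k"
    and "\<And>B'. leaky_psd_forcing_set G l B' \<Longrightarrow> k \<le> card B'"
  shows "leaky_psd_forcing_number G l = k"
  unfolding leaky_psd_forcing_number_def by (rule Least_equality) (use assms in auto)

text \<open>Symmetric in \<open>U\<close> and \<open>V\<close>: each lemma is proved for one side
  and transferred to the other by \<open>swap\<close>. Either side may be empty.\<close>

locale complete_bipartition = graph G for G :: "('a, 'b) pre_digraph" +
  fixes U V :: "'a set"
  assumes verts_eq: "verts G = U \<union> V" and disjoint: "U \<inter> V = {}"
    and arcs_ends_eq: "arcs_ends G = U \<times> V \<union> V \<times> U"
begin

lemma swap: "complete_bipartition G V U"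
  by unfold_locales (use verts_eq disjoint arcs_ends_eq in auto)

lemma finite_parts: "finite U" "finite V"
  using finite_verts by (simp_all add: verts_eq)

lemma card_verts: "card (verts G) = card U + card V"
  using finite_parts disjoint by (simp add: verts_eq card_Un_disjoint)

lemma leaky_psd_forcing_set_part:
  assumes "l < card U"
  shows "leaky_psd_forcing_set G l U"
  unfolding leaky_psd_forcing_set_def
proof (intro conjI allI impI)
  show "U \<subseteq> verts G"
    by (simp add: verts_eq)
next
  fix L
  assume L: "L \<subseteq> verts G \<and> card L = l"
  then have "finite L"
    using finite_verts finite_subset by blast
  then have "\<not> U \<subseteq> L"
    using L assms card_mono by (metis leD)
  then obtain u where u: "u \<in> U" "u \<notin> L"
    by blast
  \<comment> \<open>\<open>X\<close> collects the vertices of \<open>V\<close> forced so far, one at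
    a time and all by the same \<open>u\<close>.\<close>
  have "(leaky_psd_step G L)\<^sup>*\<^sup>* U (U \<union> X)" if "finite X" "X \<subseteq> V" for X
    using that
  proof induction
    case (insert x X)
    have "psd_force G (U \<union> X) u x"
      by (rule psd_force_isolated)
        (use u insert.hyps insert.prems disjoint in \<open>auto simp: verts_eq arcs_ends_eq\<close>)
    then have "leaky_psd_step G L (U \<union> X) (U \<union> insert x X)"
      using u by (auto simp: leaky_psd_step_def)
    moreover have "(leaky_psd_step G L)\<^sup>*\<^sup>* U (U \<union> X)"
      using insert.IH insert.prems by simp
    ultimately show ?case
      by (rule rtranclp.rtrancl_into_rtrancl[rotated])
  qed simp
  from this[of V] show "(leaky_psd_step G L)\<^sup>*\<^sup>* U (verts G)"
    using finite_parts by (simp add: verts_eq)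
qed

text \<open>Only vertices of \<open>U\<close> are adjacent to \<open>V\<close>, and all of them are
  leaks.\<close>

lemma leaky_psd_steps_Int_part:
  assumes "U \<subseteq> L" and "(leaky_psd_step G L)\<^sup>*\<^sup>* B B'"
  shows "B' \<inter> V = B \<inter> V"
  using assms(2)
proof induction
  case (step C D)
  then obtain u w where uw: "u \<notin> L" "psd_force G C u w" "D = insert w C"
    by (auto simp: leaky_psd_step_def)
  then have "w \<notin> V"
    using psd_force_white_adjacent(2)[OF uw(2)] assms(1) disjoint by (auto simp: arcs_ends_eq)
  then show ?case
    using step uw by simp
qed simp

lemma part_subset_leaky_psd_forcing_set:
  assumes "leaky_psd_forcing_set G l B" and "card U \<le> l" and "l \<le> card (verts G)"
  shows "V \<subseteq> B"
proof -
  \<comment> \<open>Leak sets have exactly \<open>l\<close> elements, so \<open>U\<close> is padded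
    with further vertices.\<close>
  obtain L where L: "U \<subseteq> L" "L \<subseteq> verts G" "card L = l"
    using exists_subset_between[of U l "verts G"] assms(2,3) finite_verts by (auto simp: verts_eq)
  then have "(leaky_psd_step G L)\<^sup>*\<^sup>* B (verts G)"
    using assms(1) by (simp add: leaky_psd_forcing_set_def)
  then show ?thesis
    using leaky_psd_steps_Int_part[OF L(1)] by (auto simp: verts_eq)
qed

lemma card_part_le_of_psd_force:
  assumes force: "psd_force G B u w" and "u \<in> U" and "\<not> U \<subseteq> B" and "finite B"
  shows "card V \<le> card B"
proof -
  let ?H = "G \<restriction> (verts G - B)"
  interpret H: wf_digraph ?H
    by (rule wellformed_induce_subgraph)
  have w: "w \<in> V" "w \<notin> B"
    using psd_force_white_adjacent[OF force] \<open>u \<in> U\<close> disjoint by (auto simp: arcs_ends_eq)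
  \<comment> \<open>This white vertex joins any two white vertices of \<open>V\<close> by a path of
    length two, so they all share one component.\<close>
  obtain x where x: "x \<in> U" "x \<notin> B"
    using \<open>\<not> U \<subseteq> B\<close> by blast
  have xv: "x \<rightarrow>\<^bsub>?H\<^esub> v" "v \<rightarrow>\<^bsub>?H\<^esub> x" if "v \<in> V - B" for v
    using that x by (auto simp: dominates_induce_subgraph_iff arcs_ends_eq verts_eq)
  have "v = w" if v: "v \<in> V - B" for v
  proof (rule psd_force_unique[OF force])
    show "u \<rightarrow>\<^bsub>G\<^esub> v"
      using \<open>u \<in> U\<close> v by (simp add: arcs_ends_eq)
    show "w \<rightarrow>\<^sup>*\<^bsub>?H\<^esub> v" "v \<rightarrow>\<^sup>*\<^bsub>?H\<^esub> w"
      using H.adj_reachable_trans[OF xv(2) H.reachable_adjI[OF xv(1)]] w v by simp_all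
  qed
  moreover have "u \<in> B"
    using force by (simp add: psd_force_def)
  \<comment> \<open>In the count, \<open>u\<close> makes up for the white vertex
    \<open>w\<close>.\<close>
  ultimately have "insert u (V - {w}) \<subseteq> B"
    by blast
  moreover have "card (insert u (V - {w})) = card V"
    using card_Suc_Diff1[OF finite_parts(2) w(1)] finite_parts \<open>u \<in> U\<close> disjoint
    by (subst card_insert_disjoint) auto
  ultimately show ?thesis
    using \<open>finite B\<close> by (metis card_mono)
qed

lemma min_card_parts_le_leaky_psd_forcing_set:
  assumes forcing: "leaky_psd_forcing_set G l B" and "l \<le> card (verts G)"
  shows "min (card U) (card V) \<le> card B"
proof (rule ccontr)
  assume "\<not> ?thesis"
  then have less: "card B < card U" "card B < card V"
    by simp_all
  have "B \<subseteq> verts G"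
    using forcing by (simp add: leaky_psd_forcing_set_def)
  then have "finite B"
    using finite_verts finite_subset by blast
  then have white: "\<not> U \<subseteq> B" "\<not> V \<subseteq> B"
    using less card_mono by (metis leD)+
  obtain L where "L \<subseteq> verts G" "card L = l"
    using obtain_subset_with_card_n[OF assms(2)] by blast
  then have "(leaky_psd_step G L)\<^sup>*\<^sup>* B (verts G)"
    using forcing by (simp add: leaky_psd_forcing_set_def)
  moreover have "B \<noteq> verts G"
    using white by (auto simp: verts_eq)
  \<comment> \<open>The first force alone gives the contradiction: at that moment both sides still
    have white vertices.\<close>
  ultimately obtain C where "leaky_psd_step G L B C"
    by (auto elim: converse_rtranclpE)
  then obtain u w where force: "psd_force G B u w"
    by (auto simp: leaky_psd_step_def)
  then have "u \<in> U \<or> u \<in> V"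
    using \<open>B \<subseteq> verts G\<close> by (auto simp: psd_force_def verts_eq)
  then show False
    using card_part_le_of_psd_force[OF force] less white \<open>finite B\<close>
      complete_bipartition.card_part_le_of_psd_force[OF swap force] by auto
qed

end

theorem theorem24:
  fixes G :: "('a, 'b) pre_digraph" and m n l :: nat
  assumes "K\<^bsub>m,n\<^esub> G" and "l \<le> m + n"
  shows "leaky_psd_forcing_number G l =
    (if l < min m n then min m n
     else if l < max m n then max m n
     else m + n)"
proof -
  obtain U V where "graph G" and parts: "verts G = U \<union> V" "U \<inter> V = {}"
    "arcs_ends G = U \<times> V \<union> V \<times> U" and card: "card U = m" "card V = n"
    using assms(1) by (auto simp: complete_bipartite_digraph_def)
  interpret graph G by fact
  interpret UV: complete_bipartition G U V
    by unfold_locales (fact parts)+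
  interpret VU: complete_bipartition G V U
    by (rule UV.swap)
  have l: "l \<le> card (verts G)"
    using assms(2) card by (simp add: UV.card_verts)
  have part: "\<exists>B. leaky_psd_forcing_set G l B \<and> card B = k" if "l < k" "k = m \<or> k = n" for k
    using that card UV.leaky_psd_forcing_set_part VU.leaky_psd_forcing_set_part by blast
  have bounds: "min m n \<le> card B" "m \<le> l \<Longrightarrow> V \<subseteq> B" "n \<le> l \<Longrightarrow> U \<subseteq> B" "finite B"
    if "leaky_psd_forcing_set G l B" for B
    using UV.min_card_parts_le_leaky_psd_forcing_set[OF that l]
      UV.part_subset_leaky_psd_forcing_set[OF that _ l]
      VU.part_subset_leaky_psd_forcing_set[OF that _ l]
      finite_subset[OF _ finite_verts, of B] that
    unfolding leaky_psd_forcing_set_def card by simp_all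
  have min_or: "min m n = m \<or> min m n = n" and max_or: "max m n = m \<or> max m n = n"
    by auto
  consider "l < min m n" | "min m n \<le> l" "l < max m n" | "max m n \<le> l"
    by linarith
  then show ?thesis
  proof cases
    case 1
    then obtain B where "leaky_psd_forcing_set G l B" "card B = min m n"
      using part[OF _ min_or] by blast
    then have "leaky_psd_forcing_number G l = min m n"
      using bounds(1) by (rule leaky_psd_forcing_number_eqI)
    then show ?thesis
      using 1 by simp
  next
    case 2
    then obtain B where B: "leaky_psd_forcing_set G l B" "card B = max m n"
      using part[OF _ max_or] by blast
    \<comment> \<open>The smaller side fits into the leaks, so \<open>B'\<close> contains the larger
      one.\<close>
    have "max m n \<le> card B'" if "leaky_psd_forcing_set G l B'" for B'
    proof (cases "m \<le> n")
      case True
      then have "V \<subseteq> B'"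
        using 2 bounds(2)[OF that] by simp
      then show ?thesis
        using True card bounds(4)[OF that] card_mono by (metis max_absorb2)
    next
      case False
      then have "U \<subseteq> B'"
        using 2 bounds(3)[OF that] by simp
      then show ?thesis
        using False card bounds(4)[OF that] card_mono by (metis max_absorb1 nat_le_linear)
    qed
    with B have "leaky_psd_forcing_number G l = max m n"
      by (rule leaky_psd_forcing_number_eqI)
    then show ?thesis
      using 2 by (auto simp: min_le_iff_disj)
  next
    case 3
    have "m + n \<le> card B" if "leaky_psd_forcing_set G l B" for B
    proof -
      \<comment> \<open>Each side can be made of leaks only, which puts the other side into
        \<open>B\<close>.\<close>
      have "verts G \<subseteq> B"
        using 3 bounds(2,3)[OF that] by (simp add: parts)
      then show ?thesis
        using bounds(4)[OF that] card card_mono UV.card_verts by metis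
    qed
    then have "leaky_psd_forcing_number G l = m + n"
      by (intro leaky_psd_forcing_number_eqI[OF leaky_psd_forcing_set_verts])
        (simp_all add: UV.card_verts card)
    then show ?thesis
      using 3 by (auto simp: less_max_iff_disj)
  qed
qed

end
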